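(* For every fixed positive integer $n$, the sequence $\mathrm{BoNa}(n,1),\mathrm{BoNa}(n,2),\ldots,\mathrm{BoNa}(n,n)$ is log-concave.
   Context: A binary plane tree is a rooted plane tree on unlabeled vertices in which every non-leaf vertex has one or two children, and every child is a left child or a right child, even if it is the only child of its parent. A 0-1-tree is a binary plane tree in which every vertex that has two children is labeled 0 or 1 (no other vertex is labeled). A right edge is an edge connecting a vertex to its right child. For $n\ge 1$, the Boolean-Narayana number $\mathrm{BoNa}(n,k)$ is the number of 0-1-trees on $n$ vertices that have exactly $k-1$ right edges. A sequence $a_1,a_2,\ldots$ (finite or infinite) of nonnegative real numbers is log-concave if $a_{i-1}a_{i+1}\leq a_i^2$ for every index $i$ for which $a_{i-1}$, $a_i$ and $a_{i+1}$ are all terms of the sequence. *)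

theory Defs
  imports Complex_Main "HOL-Library.Tree"
begin

text \<open>
  The vertices of a binary plane tree are the \<^const>\<open>Node\<close>s of a \<^type>\<open>tree\<close>, while
  \<^const>\<open>Leaf\<close> is the empty tree and stands for an absent child; so \<^const>\<open>size\<close> is the
  number of vertices. A vertex labeled 0 or 1 carries \<^term>\<open>Some False\<close> or
  \<^term>\<open>Some True\<close>, an unlabeled vertex carries \<^term>\<open>None\<close>.
\<close>

fun zero_one_tree :: "bool option tree \<Rightarrow> bool" where
  "zero_one_tree Leaf \<longleftrightarrow> True"
| "zero_one_tree (Node l a r) \<longleftrightarrow>
     (a \<noteq> None \<longleftrightarrow> l \<noteq> Leaf \<and> r \<noteq> Leaf) \<and> zero_one_tree l \<and> zero_one_tree r"

fun right_edges :: "'a tree \<Rightarrow> nat" where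
  "right_edges Leaf = 0"
| "right_edges (Node l a r) = right_edges l + right_edges r + (if r = Leaf then 0 else 1)"

text \<open>
  Only \<^prop>\<open>n \<ge> 1\<close> is meaningful. Having \<^term>\<open>k - 1\<close> right edges is written without
  truncated subtraction.
\<close>

definition BoNa :: "nat \<Rightarrow> nat \<Rightarrow> nat" where
  "BoNa n k = card {t. zero_one_tree t \<and> size t = n \<and> right_edges t + 1 = k}"

lemma finite_trees_size_le: "finite {t :: 'a::finite tree. size t \<le> n}"
proof (induction n)
  case 0
  then show ?case by simp
next
  case (Suc n)
  let ?S = "{t :: 'a tree. size t \<le> n}"
  have "{t :: 'a tree. size t \<le> Suc n}
      \<subseteq> insert Leaf ((\<lambda>(l, a, r). Node l a r) ` (?S \<times> UNIV \<times> ?S))"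
  proof
    fix t :: "'a tree"
    assume "t \<in> {t. size t \<le> Suc n}"
    then show "t \<in> insert Leaf ((\<lambda>(l, a, r). Node l a r) ` (?S \<times> UNIV \<times> ?S))"
      by (cases t) force+
  qed
  moreover have "finite (insert Leaf ((\<lambda>(l, a, r). Node l a r) ` (?S \<times> (UNIV :: 'a set) \<times> ?S)))"
    using Suc.IH by simp
  ultimately show ?case by (rule finite_subset)
qed

text \<open>The set counted by \<^const>\<open>BoNa\<close> is finite, so its \<^const>\<open>card\<close> is the true number.\<close>

lemma finite_BoNa_set: "finite {t. zero_one_tree t \<and> size t = n \<and> right_edges t + 1 = k}"
  by (rule finite_subset[OF _ finite_trees_size_le[of n]]) auto

text \<open>
  The terms of the sequence are the \<^term>\<open>a i\<close> with \<^term>\<open>i \<in> I\<close>; \<^term>\<open>I\<close> is an initial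
  segment of the positive integers for a finite sequence and all of them for an infinite one.
\<close>

definition log_concave_on :: "nat set \<Rightarrow> (nat \<Rightarrow> real) \<Rightarrow> bool" where
  "log_concave_on I a \<longleftrightarrow>
     (\<forall>i\<in>I. 0 \<le> a i) \<and>
     (\<forall>i. i \<in> I \<and> i + 1 \<in> I \<and> i + 2 \<in> I \<longrightarrow> a i * a (i + 2) \<le> (a (i + 1))\<^sup>2)"

end

theory Submission
  imports Defs "HOL-Computational_Algebra.Formal_Power_Series"
    "HOL-Computational_Algebra.Polynomial"
begin

text \<open>
  Counting vertices by \<open>x\<close> and right edges by \<open>u\<close>, the generating function \<open>B\<close> of nonempty
  0-1-trees satisfies \<open>B = x (1 + (1 + u) B + 2 u B\<^sup>2)\<close>. The kernel factors by powers of \<open>u\<close> as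
  \<open>(1 + X) + u X (1 + 2 X)\<close>, so Lagrange inversion shows that \<open>n BoNa(n, k + 1)\<close> is the product of
  \<open>n choose k\<close> and the coefficient \<open>E(k, n - k)\<close> of \<open>X\<^bsup>n-1-k\<^esup>\<close> in \<open>(1 + 2 X)\<^bsup>k\<^esup> (1 + X)\<^bsup>n-k\<^esup>\<close>.
  The numbers \<open>E\<close> satisfy the Delannoy recurrence, and for such an array the property that
  consecutive antidiagonals interlace (consecutive ratios alternate) propagates by induction
  and implies that each antidiagonal is log-concave.
\<close>

unbundle fps_syntax

section \<open>Lagrange inversion\<close>

lemma fps_X_mult_deriv_nth:
  fixes f :: "'a::comm_ring_1 fps"
  shows "(fps_X * fps_deriv f) $ m = of_nat m * f $ m"
  by (cases m) simp_all

lemma fps_X_deriv_power_nth: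
  fixes \<phi> :: "'a::{idom,ring_char_0} fps"
  shows "of_nat (Suc n) * (fps_X * fps_deriv \<phi> * \<phi> ^ n) $ m = of_nat m * (\<phi> ^ Suc n) $ m"
proof -
  have "of_nat (Suc n) * (fps_X * fps_deriv \<phi> * \<phi> ^ n) = fps_X * fps_deriv (\<phi> ^ Suc n)"
    by (simp only: fps_deriv_power' diff_Suc_1) (simp add: algebra_simps)
  then have "(of_nat (Suc n) * (fps_X * fps_deriv \<phi> * \<phi> ^ n)) $ m = of_nat m * (\<phi> ^ Suc n) $ m"
    by (simp only: fps_X_mult_deriv_nth)
  then show ?thesis
    by (simp only: fps_of_nat[symmetric] fps_mult_left_const_nth)
qed

text \<open>Induction on \<open>n\<close> for all \<open>r\<close> at once: peeling one
  \<open>B\<close> off \<open>B ^ r\<close> leaves a series composed with \<open>B\<close>, whose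
  coefficients involve those of all powers \<open>B ^ j\<close> one degree lower.\<close>

lemma lagrange_inversion:
  fixes \<phi> B :: "'a::{idom,ring_char_0} fps"
  assumes B: "B = fps_X * (\<phi> oo B)"
  shows "r \<le> n \<Longrightarrow> of_nat n * (B ^ r) $ n = of_nat r * (\<phi> ^ n) $ (n - r)"
proof (induction n arbitrary: r)
  case 0
  then show ?case by simp
next
  case (Suc n)
  have B0: "B $ 0 = 0"
    by (subst B) simp
  show ?case
  proof (cases r)
    case 0
    then show ?thesis by simp
  next
    case (Suc s)
    with Suc.prems have s: "s \<le> n" by simp
    define c where "c = (\<phi> ^ Suc n) $ (n - s)"
    have "B ^ Suc s = fps_X * ((\<phi> * fps_X ^ s) oo B)"
      using B B0 by (simp add: fps_compose_mult_distrib fps_X_power_compose mult_ac)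
    then have coeff: "(B ^ Suc s) $ Suc n = (\<Sum>j=0..n. (\<phi> * fps_X ^ s) $ j * (B ^ j) $ n)"
      by (simp add: fps_compose_nth)
    have deriv: "fps_X * fps_deriv (\<phi> * fps_X ^ s)
        = fps_X ^ s * (fps_X * fps_deriv \<phi> + of_nat s * \<phi>)"
    proof -
      have "fps_X * fps_deriv (fps_X ^ s :: 'a fps) = of_nat s * fps_X ^ s"
        by (cases s) (simp_all only: fps_deriv_power' fps_deriv_fps_X, simp_all add: algebra_simps)
      then show ?thesis
        by (simp only: fps_deriv_mult) (simp add: algebra_simps)
    qed
    have "of_nat n * (B ^ Suc s) $ Suc n
        = (\<Sum>j=0..n. (\<phi> * fps_X ^ s) $ j * (of_nat n * (B ^ j) $ n))"
      by (simp only: coeff sum_distrib_left mult.left_commute)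
    \<comment> \<open>The factor \<open>j\<close> supplied by the induction hypothesis is absorbed
      by the operator \<open>X d/dX\<close>, and the sum becomes a Cauchy product.\<close>
    also have "\<dots> = (\<Sum>j=0..n. (fps_X * fps_deriv (\<phi> * fps_X ^ s)) $ j * (\<phi> ^ n) $ (n - j))"
    proof (rule sum.cong)
      fix j assume "j \<in> {0..n}"
      then have "of_nat n * (B ^ j) $ n = of_nat j * (\<phi> ^ n) $ (n - j)"
        by (intro Suc.IH) simp
      moreover have "(fps_X * fps_deriv (\<phi> * fps_X ^ s)) $ j = of_nat j * (\<phi> * fps_X ^ s) $ j"
        by (rule fps_X_mult_deriv_nth)
      ultimately show "(\<phi> * fps_X ^ s) $ j * (of_nat n * (B ^ j) $ n)
          = (fps_X * fps_deriv (\<phi> * fps_X ^ s)) $ j * (\<phi> ^ n) $ (n - j)"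
        by (simp only: mult_ac)
    qed simp
    also have "\<dots> = (fps_X ^ s * ((fps_X * fps_deriv \<phi> + of_nat s * \<phi>) * \<phi> ^ n)) $ n"
      by (simp only: fps_mult_nth[symmetric] deriv mult.assoc)
    also have "\<dots> = ((fps_X * fps_deriv \<phi> + of_nat s * \<phi>) * \<phi> ^ n) $ (n - s)"
      using s by (simp add: fps_X_power_mult_nth)
    also have "\<dots> = (fps_X * fps_deriv \<phi> * \<phi> ^ n) $ (n - s) + of_nat s * c"
      by (simp add: c_def distrib_right mult.assoc fps_of_nat[symmetric])
    finally have *: "of_nat n * (B ^ Suc s) $ Suc n
        = (fps_X * fps_deriv \<phi> * \<phi> ^ n) $ (n - s) + of_nat s * c" .
    \<comment> \<open>The factor \<open>Suc n\<close> turns the derivative term into a multiple of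
      \<open>c\<close>; the terms combine by \<open>(n - s) + (n + 1) s = n (s + 1)\<close>.\<close>
    have "of_nat n * (of_nat (Suc n) * (B ^ Suc s) $ Suc n)
        = of_nat (Suc n) * (of_nat n * (B ^ Suc s) $ Suc n)"
      by (simp only: mult.left_commute)
    also have "\<dots> = of_nat (n - s) * c + of_nat (Suc n) * (of_nat s * c)"
      by (simp only: * distrib_left fps_X_deriv_power_nth c_def)
    also have "\<dots> = of_nat n * (of_nat (Suc s) * c)"
      using s by (simp add: of_nat_diff algebra_simps)
    finally have cancel: "of_nat n * (of_nat (Suc n) * (B ^ Suc s) $ Suc n)
        = of_nat n * (of_nat (Suc s) * c)" .
    show ?thesis
    \<comment> \<open>For \<open>n = 0\<close> the factor \<open>n\<close> cannot be cancelled;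
      there \<open>s = 0\<close> and both sides are \<open>\<phi> $ 0\<close>.\<close>
    proof (cases "n = 0")
      case True
      with s coeff show ?thesis using \<open>r = Suc s\<close> by simp
    next
      case False
      with cancel show ?thesis using \<open>r = Suc s\<close> by (simp add: c_def)
    qed
  qed
qed

section \<open>The generating function of 0-1-trees\<close>

definition zero_one_trees :: "nat \<Rightarrow> bool option tree set" where
  "zero_one_trees n = {t. zero_one_tree t \<and> size t = n}"

definition labels :: "'a tree \<Rightarrow> 'a tree \<Rightarrow> bool option set" where
  "labels l r = (if l \<noteq> Leaf \<and> r \<noteq> Leaf then {Some False, Some True} else {None})"

lemma finite_zero_one_trees: "finite (zero_one_trees n)"
  by (rule finite_subset[OF _ finite_trees_size_le[of n]]) (auto simp: zero_one_trees_def)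

lemma zero_one_trees_0: "zero_one_trees 0 = {Leaf}"
  by (auto simp: zero_one_trees_def)

lemma zero_one_tree_Node_iff:
  "zero_one_tree (Node l a r) \<longleftrightarrow> a \<in> labels l r \<and> zero_one_tree l \<and> zero_one_tree r"
  by (cases a) (auto simp: labels_def)

lemma zero_one_trees_Suc:
  "zero_one_trees (Suc n) = (\<lambda>(i, l, r, a). Node l a r) `
     (SIGMA i:{0..n}. SIGMA l:zero_one_trees i. SIGMA r:zero_one_trees (n - i). labels l r)"
  (is "_ = ?f ` ?S")
proof
  show "zero_one_trees (Suc n) \<subseteq> ?f ` ?S"
  proof
    fix t assume t: "t \<in> zero_one_trees (Suc n)"
    then obtain l a r where "t = Node l a r"
      by (cases t) (auto simp: zero_one_trees_def)
    with t have "(size l, l, r, a) \<in> ?S" "t = ?f (size l, l, r, a)"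
      by (auto simp: zero_one_trees_def zero_one_tree_Node_iff simp del: zero_one_tree.simps)
    then show "t \<in> ?f ` ?S" by blast
  qed
  show "?f ` ?S \<subseteq> zero_one_trees (Suc n)"
    by (auto simp: zero_one_trees_def zero_one_tree_Node_iff simp del: zero_one_tree.simps)
qed

definition tree_sum :: "'a::comm_ring_1 \<Rightarrow> nat \<Rightarrow> 'a" where
  "tree_sum u n = (\<Sum>t\<in>zero_one_trees n. u ^ right_edges t)"

lemma tree_sum_0 [simp]: "tree_sum u 0 = 1"
  by (simp add: tree_sum_def zero_one_trees_0)

text \<open>Split at the root, with \<open>i\<close> the size of the left subtree: the root has two
  possible labels iff both subtrees are nonempty, and starts a right edge iff
  \<open>i \<noteq> n\<close>.\<close>

lemma tree_sum_Suc:
  "tree_sum u (Suc n) = (\<Sum>i=0..n. (if i = 0 \<or> i = n then 1 else 2) * (if i = n then 1 else u)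
     * (tree_sum u i * tree_sum u (n - i)))"
proof -
  \<comment> \<open>The component \<open>i\<close> is not stored in the tree, but equals
    \<open>size l\<close>.\<close>
  have inj: "inj_on (\<lambda>(i, l, r, a). Node l a r)
     (SIGMA i:{0..n}. SIGMA l:zero_one_trees i. SIGMA r:zero_one_trees (n - i). labels l r)"
    by (auto simp: inj_on_def zero_one_trees_def)
  have fin: "finite (labels l r)" for l r :: "bool option tree"
    by (simp add: labels_def)
  have "tree_sum u (Suc n) = (\<Sum>i=0..n. \<Sum>l\<in>zero_one_trees i. \<Sum>r\<in>zero_one_trees (n - i).
      \<Sum>a\<in>labels l r. u ^ right_edges (Node l a r))"
    unfolding tree_sum_def zero_one_trees_Suc
    by (subst sum.reindex[OF inj])
      (simp add: sum.Sigma finite_zero_one_trees fin case_prod_unfold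
        del: right_edges.simps)
  also have "\<dots> = (\<Sum>i=0..n. \<Sum>l\<in>zero_one_trees i. \<Sum>r\<in>zero_one_trees (n - i).
      (if i = 0 \<or> i = n then 1 else 2) * (if i = n then 1 else u)
        * (u ^ right_edges l * u ^ right_edges r))"
  proof (intro sum.cong refl)
    fix i and l r :: "bool option tree"
    assume "i \<in> {0..n}" "l \<in> zero_one_trees i" "r \<in> zero_one_trees (n - i)"
    then have "l = Leaf \<longleftrightarrow> i = 0" "r = Leaf \<longleftrightarrow> i = n"
      by (auto simp: zero_one_trees_def)
    then show "(\<Sum>a\<in>labels l r. u ^ right_edges (Node l a r))
        = (if i = 0 \<or> i = n then 1 else 2) * (if i = n then 1 else u)
          * (u ^ right_edges l * u ^ right_edges r)"
      by (auto simp: labels_def power_add)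
  qed
  also have "\<dots> = (\<Sum>i=0..n. (if i = 0 \<or> i = n then 1 else 2) * (if i = n then 1 else u)
     * (tree_sum u i * tree_sum u (n - i)))"
    unfolding tree_sum_def sum_product unfolding sum_distrib_left ..
  finally show ?thesis .
qed

text \<open>The empty tree is dropped because composition needs constant term 0.\<close>

definition tree_fps :: "'a::comm_ring_1 \<Rightarrow> 'a fps" where
  "tree_fps u = Abs_fps (\<lambda>n. if n = 0 then 0 else tree_sum u n)"

text \<open>The root has no child (\<open>1\<close>), only a left one (\<open>X\<close>), only a
  right one (\<open>u X\<close>), or two children and two labels (\<open>2 u X^2\<close>).\<close>

definition tree_kernel :: "'a::comm_ring_1 \<Rightarrow> 'a fps" where
  "tree_kernel u = (1 + fps_X) + fps_const u * (fps_X * (1 + 2 * fps_X))"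

lemma tree_fps_eq:
  fixes u :: "'a::idom"
  shows "tree_fps u = fps_X * (tree_kernel u oo tree_fps u)"
proof -
  let ?B = "tree_fps u"
  have B0: "?B $ 0 = 0"
    by (simp add: tree_fps_def)
  \<comment> \<open>The factors 1 make every summand a Cauchy product, to be compared termwise with
    the recurrence for \<^const>\<open>tree_sum\<close>.\<close>
  have comp: "tree_kernel u oo ?B
      = 1 * 1 + ?B * 1 + fps_const u * (1 * ?B) + fps_const (2 * u) * (?B * ?B)"
  proof -
    have kernel: "tree_kernel u
        = 1 + fps_X + fps_const u * fps_X + fps_const (2 * u) * (fps_X * fps_X)"
      by (simp only: mult_2 fps_const_add[symmetric] tree_kernel_def)
        (simp add: algebra_simps del: fps_const_add)
    have "fps_const c * a oo ?B = fps_const c * (a oo ?B)" for c a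
      using B0 by (simp add: fps_compose_mult_distrib)
    then show ?thesis
      unfolding kernel using B0
      by (simp add: fps_compose_add_distrib fps_compose_mult_distrib)
  qed
  have "?B $ Suc n = (tree_kernel u oo ?B) $ n" for n
  proof -
    have "?B $ Suc n = (\<Sum>i=0..n. (1 :: 'a fps) $ i * (1 :: 'a fps) $ (n - i)
        + ?B $ i * (1 :: 'a fps) $ (n - i)
        + u * ((1 :: 'a fps) $ i * ?B $ (n - i)) + (2 * u) * (?B $ i * ?B $ (n - i)))"
      unfolding tree_fps_def fps_nth_Abs_fps
      by (auto simp: tree_sum_Suc intro!: sum.cong)
    also have "\<dots> = (tree_kernel u oo ?B) $ n"
      unfolding comp fps_add_nth fps_mult_left_const_nth
      by (simp only: fps_mult_nth sum.distrib sum_distrib_left)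
    finally show ?thesis .
  qed
  then show ?thesis
    by (intro fps_ext) (case_tac n, simp_all add: B0)
qed

section \<open>Modified Delannoy numbers\<close>

text \<open>
  In closed form, \<^term>\<open>delannoy' a b\<close> is the sum of \<open>2\<^sup>i (a choose i) (b choose (i + 1))\<close>
  over \<open>i\<close>; with all boundary values 1 the recurrence would give the Delannoy numbers.
\<close>

fun delannoy' :: "nat \<Rightarrow> nat \<Rightarrow> nat" where
  "delannoy' a 0 = 0"
| "delannoy' 0 (Suc b) = Suc b"
| "delannoy' (Suc a) (Suc b) = delannoy' a (Suc b) + delannoy' (Suc a) b + delannoy' a b"

lemma one_plus_fps_X_power_nth: "((1 + fps_X) ^ n :: 'a::comm_ring_1 fps) $ k = of_nat (n choose k)"
proof (induction n arbitrary: k)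
  case 0
  then show ?case by (cases k) simp_all
next
  case (Suc n)
  then show ?case by (cases k) (simp_all add: distrib_right)
qed

text \<open>The extra factor \<open>X\<close> replaces the index \<open>b - 1\<close> by
  \<open>b\<close> and yields 0 at \<open>b = 0\<close>.\<close>

lemma delannoy'_fps:
  "(fps_X * (1 + 2 * fps_X) ^ a * (1 + fps_X) ^ b :: 'a::comm_ring_1 fps) $ b
     = of_nat (delannoy' a b)"
proof (induction a b rule: delannoy'.induct)
  case (1 a)
  then show ?case by simp
next
  case (2 b)
  then show ?case
    by (simp only: power_0 mult_1_right) (simp add: one_plus_fps_X_power_nth del: power_Suc)
next
  case (3 a b)
  define G :: "'a fps" where "G = (1 + 2 * fps_X) ^ a * (1 + fps_X) ^ b"
  \<comment> \<open>This is \<open>(1 + 2 X) (1 + X) = (1 + X) + X (1 + 2 X) + X\<close>.\<close>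
  have "fps_X * (1 + 2 * fps_X) ^ Suc a * (1 + fps_X) ^ Suc b
     = fps_X * (1 + 2 * fps_X) ^ a * (1 + fps_X) ^ Suc b
      + fps_X * (fps_X * (1 + 2 * fps_X) ^ Suc a * (1 + fps_X) ^ b)
      + fps_X * (fps_X * (1 + 2 * fps_X) ^ a * (1 + fps_X) ^ b :: 'a fps)"
    by (simp add: algebra_simps)
  then show ?case
    using 3 by (simp del: power_Suc)
qed

section \<open>Interlacing and log-concavity of the antidiagonals\<close>

lemma delannoy'_pos: "b > 0 \<Longrightarrow> delannoy' a b > 0"
  by (induction a b rule: delannoy'.induct) auto

lemma delannoy'_1: "delannoy' (Suc 0) b = b\<^sup>2"
proof (induction b)
  case (Suc b)
  then show ?case by (cases b) (simp_all add: power2_eq_square)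
qed simp

text \<open>The assumptions place a ratio of neighbours on antidiagonal \<open>a + b + 1\<close>
  between two consecutive ratios on the next one. Multiply them and cancel.\<close>

lemma delannoy'_log_concave_of_interlacing:
  assumes "delannoy' (a + 2) b * delannoy' a (b + 1) \<le> delannoy' (a + 1) (b + 1) * delannoy' (a + 1) b"
    and "delannoy' (a + 1) b * delannoy' a (b + 2) \<le> delannoy' (a + 1) (b + 1) * delannoy' a (b + 1)"
  shows "delannoy' a (b + 2) * delannoy' (a + 2) b \<le> (delannoy' (a + 1) (b + 1))\<^sup>2"
proof -
  have "(delannoy' a (b + 2) * delannoy' (a + 2) b) * delannoy' a (b + 1)
      \<le> delannoy' a (b + 2) * (delannoy' (a + 1) (b + 1) * delannoy' (a + 1) b)"
    using mult_left_mono[OF assms(1), of "delannoy' a (b + 2)"] by (simp add: mult_ac)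
  also have "\<dots> \<le> (delannoy' (a + 1) (b + 1))\<^sup>2 * delannoy' a (b + 1)"
    using mult_left_mono[OF assms(2), of "delannoy' (a + 1) (b + 1)"]
    by (simp add: mult_ac power2_eq_square)
  finally show ?thesis
    using delannoy'_pos[of "b + 1" a] by simp
qed

lemma delannoy'_interlacing:
  "delannoy' (a + 2) b * delannoy' a (b + 1) \<le> delannoy' (a + 1) (b + 1) * delannoy' (a + 1) b
   \<and> delannoy' (a + 1) b * delannoy' a (b + 2) \<le> delannoy' (a + 1) (b + 1) * delannoy' a (b + 1)"
  (is "?P a b \<and> ?Q a b")
proof (induction "a + b" arbitrary: a b rule: less_induct)
  case less
  show ?case
  proof (cases b)
    case 0
    then show ?thesis by simp
  next
    case (Suc c)
    \<comment> \<open>Applying the recurrence to the first factor on each side of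
      \<open>?P a b\<close> and cancelling leaves the sum of log-concavity at \<open>(a, c)\<close>
      and \<open>?Q a c\<close>.\<close>
    have "?P a c \<and> ?Q a c"
      using Suc by (intro less) simp
    with delannoy'_log_concave_of_interlacing[of a c]
    have "?P a b"
      by (simp add: Suc algebra_simps power2_eq_square)
    moreover have "?Q a b"
    proof (cases a)
      case 0
      \<comment> \<open>With row 0 equal to \<open>b\<close> and row 1 to \<open>b^2\<close>, this
        is \<open>?Q 0 (c + 1)\<close>.\<close>
      have "(c + 1)\<^sup>2 * (c + 3) \<le> (c + 2)\<^sup>2 * (c + 2)"
        by (simp add: algebra_simps power2_eq_square)
      with 0 Suc show ?thesis
        by (simp add: delannoy'_1 numeral_eq_Suc del: delannoy'.simps(3))
    next
      case (Suc d)
      \<comment> \<open>Likewise \<open>?Q a b\<close> reduces to the sum of log-concavity at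
        \<open>(d, b)\<close> and \<open>?P d b\<close>.\<close>
      have "?P d b \<and> ?Q d b"
        using Suc by (intro less) simp
      with delannoy'_log_concave_of_interlacing[of d b]
      show ?thesis
        by (simp add: Suc \<open>b = Suc c\<close> algebra_simps power2_eq_square)
    qed
    ultimately show ?thesis ..
  qed
qed

lemma delannoy'_log_concave:
  "delannoy' a (b + 2) * delannoy' (a + 2) b \<le> (delannoy' (a + 1) (b + 1))\<^sup>2"
  using delannoy'_interlacing delannoy'_log_concave_of_interlacing by blast

section \<open>The explicit formula\<close>

text \<open>Taking the polynomial variable for \<open>u\<close> makes the number of right edges the
  degree.\<close>

lemma coeff_tree_sum:
  "coeff (tree_sum (monom 1 1) n :: int poly) k = int (BoNa n (k + 1))"
proof -
  have "coeff (tree_sum (monom 1 1) n :: int poly) k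
      = (\<Sum>t\<in>zero_one_trees n. if right_edges t = k then 1 else 0)"
    by (simp add: tree_sum_def coeff_sum monom_power)
  also have "\<dots> = int (card {t \<in> zero_one_trees n. right_edges t = k})"
    by (simp add: sum.If_cases finite_zero_one_trees Int_def)
  also have "{t \<in> zero_one_trees n. right_edges t = k}
      = {t. zero_one_tree t \<and> size t = n \<and> right_edges t + 1 = k + 1}"
    by (auto simp: zero_one_trees_def)
  finally show ?thesis by (simp add: BoNa_def)
qed

text \<open>The binomial theorem separates the powers of \<open>u\<close>; the accompanying
  \<open>X ^ k\<close> shifts the coefficient index to \<open>n - k\<close>, where
  \<open>delannoy'_fps\<close> applies.\<close>

lemma tree_kernel_power_nth:
  fixes u :: "'a::comm_ring_1"
  shows "(fps_X * tree_kernel u ^ n) $ n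
    = (\<Sum>k\<le>n. of_nat ((n choose k) * delannoy' k (n - k)) * u ^ k)"
proof -
  have "fps_X * tree_kernel u ^ n = (\<Sum>k\<le>n. fps_const (of_nat (n choose k) * u ^ k) *
      (fps_X ^ k * (fps_X * (1 + 2 * fps_X) ^ k * (1 + fps_X) ^ (n - k))))"
    unfolding tree_kernel_def
    by (subst add.commute, subst binomial_ring)
      (simp add: sum_distrib_left power_mult_distrib fps_of_nat[symmetric] mult_ac
        flip: fps_const_mult fps_const_power)
  also have "\<dots> $ n = (\<Sum>k\<le>n. of_nat (n choose k) * u ^ k * of_nat (delannoy' k (n - k)))"
    unfolding fps_sum_nth fps_mult_left_const_nth fps_X_power_mult_nth
    by (intro sum.cong) (auto simp only: delannoy'_fps atMost_iff not_less[symmetric] if_False)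
  finally show ?thesis
    by (simp add: mult_ac)
qed

theorem BoNa_formula:
  assumes "k \<le> n" "n \<ge> 1"
  shows "n * BoNa n (k + 1) = (n choose k) * delannoy' k (n - k)"
proof -
  define u :: "int poly" where "u = monom 1 1"
  have "of_nat n * tree_sum u n = (tree_kernel u ^ n) $ (n - 1)"
    using lagrange_inversion[OF tree_fps_eq[of u], of 1 n] assms by (simp add: tree_fps_def)
  also have "\<dots> = (fps_X * tree_kernel u ^ n) $ n"
    using assms by simp
  also have "\<dots> = (\<Sum>j\<le>n. of_nat ((n choose j) * delannoy' j (n - j)) * u ^ j)"
    by (rule tree_kernel_power_nth)
  finally have "coeff (of_nat n * tree_sum u n) k
      = coeff (\<Sum>j\<le>n. of_nat ((n choose j) * delannoy' j (n - j)) * u ^ j) k"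
    by simp
  then have "int (n * BoNa n (k + 1)) = int ((n choose k) * delannoy' k (n - k))"
    using assms
    by (simp add: u_def coeff_tree_sum[simplified] coeff_sum monom_power of_nat_poly
        if_distrib sum.delta flip: of_nat_mult cong: if_cong)
  then show ?thesis
    by (simp only: of_nat_eq_iff)
qed

section \<open>Log-concavity of binomial coefficients and of the Boolean-Narayana numbers\<close>

lemma binomial_log_concave:
  "(n choose k) * (n choose (k + 2)) \<le> (n choose (k + 1))\<^sup>2"
proof (cases "k + 2 \<le> n")
  case True
  have absorb: "Suc j * (n choose Suc j) = (n - j) * (n choose j)" for j
    by (metis binomial_absorb_comp binomial_absorption)
  \<comment> \<open>The multiplier is positive as \<open>k + 2 \<le> n\<close>; after absorption it
    remains to compare \<open>(n - k - 1) (k + 1)\<close> with it.\<close>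
  have "(n - k) * (k + 2) * ((n choose k) * (n choose (k + 2)))
      = ((n - k) * (n choose k)) * (Suc (Suc k) * (n choose Suc (Suc k)))"
    by (simp only: add_2_eq_Suc' mult_ac)
  also have "\<dots> = (n - Suc k) * (k + 1) * (n choose (k + 1))\<^sup>2"
    unfolding absorb[symmetric, of k] absorb[of "Suc k"]
    by (simp only: power2_eq_square Suc_eq_plus1 mult_ac)
  also have "\<dots> \<le> (n - k) * (k + 2) * (n choose (k + 1))\<^sup>2"
    by (intro mult_right_mono mult_mono) auto
  finally show ?thesis
    using True by simp
next
  case False
  then have "n choose (k + 2) = 0"
    by (intro binomial_eq_0) simp
  then show ?thesis
    by (simp only: mult_0_right le0)
qed

theorem corollary5p2:
  fixes n :: nat
  assumes "n \<ge> 1"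
  shows "log_concave_on {1..n} (\<lambda>k. real (BoNa n k))"
proof -
  have "BoNa n i * BoNa n (i + 2) \<le> (BoNa n (i + 1))\<^sup>2" if i: "1 \<le> i" "i + 2 \<le> n" for i
  proof -
    \<comment> \<open>The three terms then lie on the antidiagonal
      \<open>a + b + 2 = n\<close>.\<close>
    define a b where "a = i - 1" and "b = n - i - 1"
    have n: "i = a + 1" "n - a = b + 2" "n - (a + 1) = b + 1" "n - (a + 2) = b" "a + 2 \<le> n"
      using i by (auto simp: a_def b_def)
    have formula: "n * BoNa n i = (n choose a) * delannoy' a (b + 2)"
      "n * BoNa n (i + 1) = (n choose (a + 1)) * delannoy' (a + 1) (b + 1)"
      "n * BoNa n (i + 2) = (n choose (a + 2)) * delannoy' (a + 2) b"
      using BoNa_formula[of a n] BoNa_formula[of "a + 1" n] BoNa_formula[of "a + 2" n] n assms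
      by (simp_all add: numeral_eq_Suc del: delannoy'.simps)
    \<comment> \<open>Multiplying by \<open>n^2\<close>, cancelled at the end, reduces the claim to
      a product of two log-concave sequences.\<close>
    have "n\<^sup>2 * (BoNa n i * BoNa n (i + 2)) = (n * BoNa n i) * (n * BoNa n (i + 2))"
      by (simp add: power2_eq_square)
    also have "\<dots> = ((n choose a) * (n choose (a + 2)))
        * (delannoy' a (b + 2) * delannoy' (a + 2) b)"
      unfolding formula by (simp only: mult_ac)
    also have "\<dots> \<le> (n choose (a + 1))\<^sup>2 * (delannoy' (a + 1) (b + 1))\<^sup>2"
      by (intro mult_mono binomial_log_concave delannoy'_log_concave) auto
    also have "\<dots> = n\<^sup>2 * (BoNa n (i + 1))\<^sup>2"
      unfolding power_mult_distrib[symmetric] formula ..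
    finally show ?thesis
      using assms by simp
  qed
  then show ?thesis
    by (auto simp: log_concave_on_def simp flip: of_nat_mult of_nat_power)
qed

end
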